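(* Let $g$ be a derivator, $\mathbb F\in\{\mathbb R,\mathbb C\}$, $n\in\mathbb N$, and let $x_0,\dots,x_n\in\mathbb R_+$ be $n+1$ points with $g(x_i)\ne g(x_j)$ for $i\ne j$. Then for all $t_0,\dots,t_n\in\mathbb F$ there is a unique $p\in\operatorname{P}_n(\mathbb F)$ such that $$p(x_i)=t_i,\qquad i\in\{0,\dots,n\}.$$ Furthermore, if the points are ordered from left to right (that is, $g(x_i)<g(x_j)$ whenever $i<j$), then for all $y_0\in\mathbb R$, $$\begin{vmatrix}1&g_{y_0,1}(x_0)&\dots&g_{y_0,n}(x_0)\\1&g_{y_0,1}(x_1)&\dots&g_{y_0,n}(x_1)\\\vdots&\vdots&\ddots&\vdots\\1&g_{y_0,1}(x_n)&\dots&g_{y_0,n}(x_n)\end{vmatrix}>0.$$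
   Context: $\mathbb N=\{0,1,2,\dots\}$. A derivator is a left-continuous nondecreasing function $g:\mathbb R\to\mathbb R$; $\mu_g$ is the Lebesgue–Stieltjes measure with $\mu_g([a,b))=g(b)-g(a)$. Write $g(t^+)$ for the right-hand limit and $D_g=\{t\in\mathbb R:g(t^+)>g(t)\}$. $\mathbb R_+$ is the disjoint union of $\mathbb R$ and a formal copy $\{t^+:t\in D_g\}$ of $D_g$; $g$ is extended to $\mathbb R_+$ by letting $g(t^+)$ be the right-hand limit of $g$ at $t$. Put $\int_x^y f\,d\mu_g=\int_{[x,y)}f\,d\mu_g$ if $y\ge x$ and $-\int_{[y,x)}f\,d\mu_g$ if $y<x$. For $x_0\in\mathbb R$ the $g$-monomials are $g_{x_0,0}(x)=1$ and $g_{x_0,n}(x)=n\int_{x_0}^x g_{x_0,n-1}\,d\mu_g$ for $n\ge1$, $x\in\mathbb R$. $\operatorname{P}_n(\mathbb F)$ is the $\mathbb F$-vector space of functions $\mathbb R\to\mathbb F$ spanned by $g_{x_0,0},\dots,g_{x_0,n}$ (it does not depend on $x_0$). Its elements are evaluated at $t^+$ ($t\in D_g$) by the right-hand limit at $t$. *)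

theory Defs
  imports
    "HOL-Analysis.Analysis"
    "HOL-Library.Function_Algebras"
    "Jordan_Normal_Form.Determinant"
begin

definition derivator :: "(real \<Rightarrow> real) \<Rightarrow> bool" where
  "derivator g \<longleftrightarrow> mono g \<and> (\<forall>t. continuous (at_left t) g)"

text \<open>
  The library's \<^const>\<open>interval_measure\<close> expects a right-continuous function and gives
  mass \<open>F b - F a\<close> to \<open>{a<..b}\<close>. For left-continuous \<open>g\<close> the function \<open>\<lambda>t. - g (- t)\<close> is
  right-continuous, and reflecting its measure back gives mass \<open>g b - g a\<close> to \<open>{a..<b}\<close>.
\<close>

definition ls_measure :: "(real \<Rightarrow> real) \<Rightarrow> real measure" where
  "ls_measure g = distr (interval_measure (\<lambda>t. - g (- t))) borel uminus"

lemma sets_ls_measure [simp, measurable_cong]: "sets (ls_measure g) = sets borel"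
  by (simp add: ls_measure_def)

lemma emeasure_ls_measure:
  assumes "derivator g" and "a \<le> b"
  shows "emeasure (ls_measure g) {a..<b} = ennreal (g b - g a)"
proof -
  have cont: "continuous (at_right t) (\<lambda>t. - g (- t))" for t
  proof -
    have "(g \<longlongrightarrow> g (- t)) (at_left (- t))"
      using assms(1) by (simp add: derivator_def continuous_within)
    then have "((\<lambda>s. g (- s)) \<longlongrightarrow> g (- t)) (at_right t)"
      by (simp add: at_left_minus[of "- t"] filterlim_filtermap)
    then show ?thesis
      by (simp add: continuous_within tendsto_minus)
  qed
  have mono: "- g (- x) \<le> - g (- y)" if "x \<le> y" for x y
    using assms(1) that by (simp add: derivator_def mono_def)
  have vimage: "uminus -` {a..<b} = {- b<..- a}"
    by auto
  have "emeasure (ls_measure g) {a..<b} =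
      emeasure (interval_measure (\<lambda>t. - g (- t))) {- b<..- a}"
    unfolding ls_measure_def by (subst emeasure_distr) (simp_all add: vimage)
  also have "\<dots> = ennreal (g b - g a)"
    using emeasure_interval_measure_Ioc[of "- b" "- a" "\<lambda>t. - g (- t)"] assms(2) mono cont
    by simp
  finally show ?thesis .
qed

definition jump_set :: "(real \<Rightarrow> real) \<Rightarrow> real set" where
  "jump_set g = {t. Lim (at_right t) g > g t}"

text \<open>
  The left summand of \<open>real_plus g\<close> consists of the ordinary points \<open>t\<close>, the right one of the
  formal points \<open>t\<^sup>+\<close>.
\<close>

definition real_plus :: "(real \<Rightarrow> real) \<Rightarrow> (real + real) set" where
  "real_plus g = UNIV <+> jump_set g"

fun eval_plus :: "(real \<Rightarrow> 'a::t2_space) \<Rightarrow> real + real \<Rightarrow> 'a" where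
  "eval_plus f (Inl t) = f t"
| "eval_plus f (Inr t) = Lim (at_right t) f"

definition ls_integral :: "(real \<Rightarrow> real) \<Rightarrow> real \<Rightarrow> real \<Rightarrow> (real \<Rightarrow> real) \<Rightarrow> real" where
  "ls_integral g x y f =
     (if x \<le> y then (LINT s:{x..<y}|ls_measure g. f s) else - (LINT s:{y..<x}|ls_measure g. f s))"

primrec gmonomial :: "(real \<Rightarrow> real) \<Rightarrow> real \<Rightarrow> nat \<Rightarrow> real \<Rightarrow> real" where
  "gmonomial g x0 0 = (\<lambda>x. 1)"
| "gmonomial g x0 (Suc n) = (\<lambda>x. real (Suc n) * ls_integral g x0 x (gmonomial g x0 n))"

text \<open>
  The space \<open>P\<^sub>n\<close> over the field \<open>'a\<close>, spanned by the \<open>g\<close>-monomials centred at \<open>z0\<close>. As a set it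
  does not depend on \<open>z0\<close>; the centre is kept as a parameter so that statements can be made
  for every choice of it.
\<close>

definition gpolys :: "(real \<Rightarrow> real) \<Rightarrow> real \<Rightarrow> nat \<Rightarrow> (real \<Rightarrow> 'a::real_normed_field) set" where
  "gpolys g z0 n =
     module.span (\<lambda>c f x. c * f x) ((\<lambda>k x. of_real (gmonomial g z0 k x)) ` {..n})"

interpretation fun_space: vector_space "\<lambda>(c::'a::field) (f::real \<Rightarrow> 'a) x. c * f x"
  by unfold_locales (auto simp: fun_eq_iff algebra_simps)

lemma gpolys_iff:
  fixes p :: "real \<Rightarrow> 'a::real_normed_field"
  shows "p \<in> gpolys g z0 n \<longleftrightarrow> (\<exists>c. p = (\<lambda>x. \<Sum>k\<le>n. c k * of_real (gmonomial g z0 k x)))"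
proof -
  let ?m = "\<lambda>k x. of_real (gmonomial g z0 k x) :: 'a"
  have sum_apply: "(\<Sum>k\<in>A. h k) x = (\<Sum>k\<in>A. h k x)"
    for A :: "nat set" and h :: "nat \<Rightarrow> real \<Rightarrow> 'a" and x
    by (induction A rule: infinite_finite_induct) auto
  have "fun_space.span (?m ` {..n}) \<subseteq> {p. \<exists>c. p = (\<lambda>x. \<Sum>k\<le>n. c k * ?m k x)}"
  proof (rule fun_space.span_minimal)
    show "?m ` {..n} \<subseteq> {p. \<exists>c. p = (\<lambda>x. \<Sum>k\<le>n. c k * ?m k x)}"
    proof clarify
      fix j assume "j \<le> n"
      then show "\<exists>c. ?m j = (\<lambda>x. \<Sum>k\<le>n. c k * ?m k x)"
        by (intro exI[of _ "\<lambda>k. if k = j then 1 else 0"]) (simp add: if_distribR sum.delta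
            if_distrib[of "\<lambda>c. c * _"] cong: if_cong)
    qed
    show "fun_space.subspace {p. \<exists>c. p = (\<lambda>x. \<Sum>k\<le>n. c k * ?m k x)}"
    proof (rule fun_space.subspaceI)
      show "0 \<in> {p. \<exists>c. p = (\<lambda>x. \<Sum>k\<le>n. c k * ?m k x)}"
        by (auto intro!: exI[of _ "\<lambda>_. 0"] simp: fun_eq_iff)
    next
      fix p q
      assume "p \<in> {p. \<exists>c. p = (\<lambda>x. \<Sum>k\<le>n. c k * ?m k x)}"
        and "q \<in> {p. \<exists>c. p = (\<lambda>x. \<Sum>k\<le>n. c k * ?m k x)}"
      then obtain c d where "p = (\<lambda>x. \<Sum>k\<le>n. c k * ?m k x)" "q = (\<lambda>x. \<Sum>k\<le>n. d k * ?m k x)"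
        by blast
      then show "p + q \<in> {p. \<exists>c. p = (\<lambda>x. \<Sum>k\<le>n. c k * ?m k x)}"
        by (auto intro!: exI[of _ "\<lambda>k. c k + d k"]
            simp: fun_eq_iff distrib_right sum.distrib)
    next
      fix a p
      assume "p \<in> {p. \<exists>c. p = (\<lambda>x. \<Sum>k\<le>n. c k * ?m k x)}"
      then obtain c where "p = (\<lambda>x. \<Sum>k\<le>n. c k * ?m k x)"
        by blast
      then show "(\<lambda>x. a * p x) \<in> {p. \<exists>c. p = (\<lambda>x. \<Sum>k\<le>n. c k * ?m k x)}"
        by (auto intro!: exI[of _ "\<lambda>k. a * c k"] simp: fun_eq_iff sum_distrib_left mult.assoc)
    qed
  qed
  moreover have "(\<lambda>x. \<Sum>k\<le>n. c k * ?m k x) \<in> fun_space.span (?m ` {..n})" for c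
  proof -
    have "(\<Sum>k\<le>n. (\<lambda>x. c k * ?m k x)) \<in> fun_space.span (?m ` {..n})"
      by (intro fun_space.span_sum fun_space.span_scale fun_space.span_base imageI) auto
    moreover have "(\<Sum>k\<le>n. (\<lambda>x. c k * ?m k x)) = (\<lambda>x. \<Sum>k\<le>n. c k * ?m k x)"
      by (simp add: fun_eq_iff sum_apply)
    ultimately show ?thesis
      by simp
  qed
  ultimately show ?thesis
    unfolding gpolys_def by blast
qed

end

theory Submission
  imports Defs
begin

text \<open>
  Subtracting consecutive rows of the matrix \<open>g\<^bsub>y,k\<^esub>(x\<^sub>i)\<close> and using
  \<open>g\<^bsub>y,k+1\<^esub>(v) - g\<^bsub>y,k+1\<^esub>(u) = (k+1) \<integral>\<^bsub>[u,v)\<^esub> g\<^bsub>y,k\<^esub> d\<mu>\<^sub>g\<close>, the determinant becomes \<open>n!\<close> times the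
  determinant with rows \<open>\<integral>\<^bsub>[x\<^sub>i,x\<^bsub>i+1\<^esub>)\<^esub> g\<^bsub>y,k\<^esub> d\<mu>\<^sub>g\<close>. By linearity in each row this is an iterated integral of
  the smaller determinants \<open>det g\<^bsub>y,k\<^esub>(s\<^sub>i)\<close> over \<open>s\<^sub>i \<in> [x\<^sub>i,x\<^bsub>i+1\<^esub>)\<close>. Almost everywhere
  \<open>g(s\<^sub>i) < g(x\<^bsub>i+1\<^esub>) \<le> g(s\<^bsub>i+1\<^esub>)\<close>, so the integrand is positive by induction, and the intervals have positive
  measure. Unique interpolation follows from positivity after sorting the points.
\<close>

section \<open>Determinants with integrated rows\<close>

text \<open>Laplace expansion along row \<open>j\<close>: its cofactors do not involve that row, so
  the coefficients \<open>c\<close> are the same for every \<open>v\<close>. This is what lets an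
  integral in one row be moved outside the determinant.\<close>

lemma det_row_linear:
  fixes B :: "nat \<Rightarrow> nat \<Rightarrow> 'a::comm_ring_1"
  assumes "j < n"
  obtains c where "\<And>v. Determinant.det (Matrix.mat n n (\<lambda>(i, k). if i = j then v k else B i k))
    = (\<Sum>k<n. v k * c k)"
proof
  fix v :: "nat \<Rightarrow> 'a"
  define A where "A = (\<lambda>v. Matrix.mat n n (\<lambda>(i, k). if i = j then v k else B i k))"
  have "mat_delete (A v) j k = mat_delete (A (\<lambda>_. 0)) j k" for k
    using assms by (auto simp: A_def mat_delete_def)
  then have "cofactor (A v) j k = cofactor (A (\<lambda>_. 0)) j k" for k
    by (simp add: cofactor_def)
  moreover have "A v \<in> carrier_mat n n"
    by (simp add: A_def)
  ultimately have "Determinant.det (A v) = (\<Sum>k<n. A v $$ (j, k) * cofactor (A (\<lambda>_. 0)) j k)"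
    using laplace_expansion_row[of "A v" n j] assms by simp
  also have "\<dots> = (\<Sum>k<n. v k * cofactor (A (\<lambda>_. 0)) j k)"
    using assms by (intro sum.cong) (auto simp: A_def)
  finally show "Determinant.det (Matrix.mat n n (\<lambda>(i, k). if i = j then v k else B i k))
    = (\<Sum>k<n. v k * cofactor (A (\<lambda>_. 0)) j k)"
    by (simp add: A_def)
qed

lemma det_scale_columns:
  fixes f :: "nat \<Rightarrow> nat \<Rightarrow> 'a::comm_ring_1"
  shows "Determinant.det (Matrix.mat n n (\<lambda>(i, k). c k * f i k)) =
    (\<Prod>k<n. c k) * Determinant.det (Matrix.mat n n (\<lambda>(i, k). f i k))"
proof -
  let ?A = "Matrix.mat n n (\<lambda>(i, k). f i k)"
  have "Matrix.mat n n (\<lambda>(i, k). c k * f i k) = ?A * mat_diag n c"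
    by (subst mat_diag_mult_right[of _ n]) (auto simp: mult.commute)
  moreover have "Determinant.det (mat_diag n c) = (\<Prod>k<n. c k)"
    by (subst det_lower_triangular[of n])
      (auto simp: mat_diag_def prod_list_diag_prod lessThan_atLeast0)
  ultimately show ?thesis
    by (simp add: det_mult[of _ n] mult.commute)
qed

text \<open>Left multiplication by a unitriangular matrix \<open>L\<close> subtracts from each row
  its predecessor. The column of ones turns into the first unit vector, and expanding along it
  leaves the minor on the right.\<close>

lemma det_consecutive_differences:
  fixes f :: "nat \<Rightarrow> nat \<Rightarrow> 'a::comm_ring_1"
  assumes "\<And>i. i \<le> n \<Longrightarrow> f i 0 = 1"
  shows "Determinant.det (Matrix.mat (Suc n) (Suc n) (\<lambda>(i, k). f i k)) =
    Determinant.det (Matrix.mat n n (\<lambda>(i, k). f (Suc i) (Suc k) - f i (Suc k)))"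
proof -
  define L :: "'a Matrix.mat" where "L = Matrix.mat (Suc n) (Suc n)
    (\<lambda>(i, j). (if j = i then 1 else 0) - (if Suc j = i then 1 else 0))"
  \<comment> \<open>Row 0 has no predecessor and stays unchanged; the case split prevents
    \<open>i - 1\<close> from truncating to 0 there.\<close>
  define D :: "'a Matrix.mat" where "D = Matrix.mat (Suc n) (Suc n)
    (\<lambda>(i, k). f i k - (if i = 0 then 0 else f (i - 1) k))"
  let ?A = "Matrix.mat (Suc n) (Suc n) (\<lambda>(i, k). f i k)"
  have "L * ?A = D"
  proof (rule eq_matI)
    fix i k assume "i < dim_row D" "k < dim_col D"
    then have ik: "i < Suc n" "k < Suc n"
      by (auto simp: D_def)
    have "(L * ?A) $$ (i, k) =
        (\<Sum>j<Suc n. ((if j = i then 1 else 0) - (if Suc j = i then 1 else 0)) * f j k)"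
      using ik by (simp add: L_def scalar_prod_def lessThan_atLeast0 del: sum.lessThan_Suc
          sum.op_ivl_Suc)
    also have "\<dots> = (\<Sum>j<Suc n. if j = i then f j k else 0) -
        (\<Sum>j<Suc n. if Suc j = i then f j k else 0)"
      by (subst sum_subtractf[symmetric], rule sum.cong) auto
    also have "(\<Sum>j<Suc n. if j = i then f j k else 0) = f i k"
      using ik by (simp add: sum.delta del: sum.lessThan_Suc)
    also have "(\<Sum>j<Suc n. if Suc j = i then f j k else 0) = (if i = 0 then 0 else f (i - 1) k)"
      using ik by (cases i) (simp_all add: sum.delta del: sum.lessThan_Suc)
    finally show "(L * ?A) $$ (i, k) = D $$ (i, k)"
      using ik by (simp add: D_def)
  qed (auto simp: L_def D_def)
  moreover have "Determinant.det L = 1"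
    by (subst det_lower_triangular[of "Suc n"])
      (auto simp: L_def prod_list_diag_prod intro!: prod.neutral)
  ultimately have "Determinant.det ?A = Determinant.det D"
    using det_mult[of L "Suc n" ?A] by (simp add: L_def)
  also have "\<dots> = (\<Sum>i<Suc n. D $$ (i, 0) * cofactor D i 0)"
    by (rule laplace_expansion_column) (auto simp: D_def)
  also have "\<dots> = (\<Sum>i<Suc n. if i = 0 then cofactor D i 0 else 0)"
    using assms by (intro sum.cong) (auto simp: D_def)
  also have "\<dots> = Determinant.det (mat_delete D 0 0)"
    by (simp add: sum.delta cofactor_def del: sum.lessThan_Suc)
  also have "mat_delete D 0 0 = Matrix.mat n n (\<lambda>(i, k). f (Suc i) (Suc k) - f i (Suc k))"
    by (auto simp: D_def mat_delete_def)
  finally show ?thesis .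
qed

section \<open>Positivity under integration\<close>

text \<open>The integral is nonnegative. If it were 0, the integrand would vanish almost everywhere,
  which for positive \<open>f\<close> forces \<open>A\<close> to be null.\<close>

lemma set_integral_pos:
  fixes f :: "'a \<Rightarrow> real"
  assumes int: "set_integrable M A f" and A: "A \<in> sets M" "emeasure M A \<noteq> 0"
    and pos: "AE s\<in>A in M. f s > 0"
  shows "(LINT s:A|M. f s) > 0"
proof -
  let ?h = "\<lambda>s. indicator A s *\<^sub>R f s"
  have h: "integrable M ?h" "AE s in M. ?h s \<ge> 0"
    using int pos by (auto simp: set_integrable_def indicator_def elim!: AE_mp)
  have "(LINT s|M. ?h s) \<noteq> 0"
  proof
    assume "(LINT s|M. ?h s) = 0"
    then have "AE s in M. ?h s = 0"
      using integral_nonneg_eq_0_iff_AE[OF h] by simp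
    with pos have "AE s in M. s \<notin> A"
      by eventually_elim (auto simp: indicator_def)
    with A show False
      using AE_iff_measurable[of A M "\<lambda>s. s \<notin> A"] sets.sets_into_space[of A M] by auto
  qed
  with integral_nonneg_AE[OF h(2)] show ?thesis
    by (simp add: set_lebesgue_integral_def)
qed

text \<open>Rows are integrated one at a time. The sets \<open>J i\<close> carry almost all of
  \<open>I i\<close> and allow \<open>pos\<close> to be assumed only at well-placed sample
  points.\<close>

lemma det_integral_rows_pos:
  fixes \<phi> :: "nat \<Rightarrow> 'a \<Rightarrow> real"
  assumes int: "\<And>i k. i < n \<Longrightarrow> k < n \<Longrightarrow> set_integrable M (I i) (\<phi> k)"
    and I: "\<And>i. i < n \<Longrightarrow> I i \<in> sets M" "\<And>i. i < n \<Longrightarrow> emeasure M (I i) \<noteq> 0"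
    and J: "\<And>i. i < n \<Longrightarrow> AE s\<in>I i in M. s \<in> J i"
    and pos: "\<And>s. (\<And>i. i < n \<Longrightarrow> s i \<in> J i) \<Longrightarrow>
      Determinant.det (Matrix.mat n n (\<lambda>(i, k). \<phi> k (s i))) > 0"
  shows "Determinant.det (Matrix.mat n n (\<lambda>(i, k). LINT s:I i|M. \<phi> k s)) > 0"
proof -
  \<comment> \<open>Hybrid determinants: the first \<open>m\<close> rows are integrated, the others
    evaluated at \<open>s i\<close>. The case \<open>m = 0\<close> is \<open>pos\<close>, the case
    \<open>m = n\<close> the goal.\<close>
  have "Determinant.det (Matrix.mat n n
      (\<lambda>(i, k). if i < m then LINT s:I i|M. \<phi> k s else \<phi> k (s i))) > 0"
    if "m \<le> n" "\<And>i. m \<le> i \<Longrightarrow> i < n \<Longrightarrow> s i \<in> J i" for m s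
    using that
  proof (induction m arbitrary: s)
    case 0
    then show ?case
      using pos[of s] by simp
  next
    case (Suc m)
    let ?B = "\<lambda>i k. if i < m then LINT s:I i|M. \<phi> k s else \<phi> k (s i)"
    have m: "m < n"
      using Suc.prems by simp
    obtain c where c: "\<And>v. Determinant.det (Matrix.mat n n
        (\<lambda>(i, k). if i = m then v k else ?B i k)) = (\<Sum>k<n. v k * c k)"
      using det_row_linear[OF m, of ?B] by blast
    \<comment> \<open>The induction hypothesis is applied to \<open>s\<close> with its entry at
      \<open>m\<close> replaced by the integration variable; hence \<open>s\<close> is kept
      arbitrary.\<close>
    have step: "(\<Sum>k<n. \<phi> k \<sigma> * c k) > 0" if "\<sigma> \<in> J m" for \<sigma>
    proof -
      have "0 < Determinant.det (Matrix.mat n n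
          (\<lambda>(i, k). if i < m then LINT s:I i|M. \<phi> k s else \<phi> k ((s(m := \<sigma>)) i)))"
        using Suc.prems that by (intro Suc.IH) auto
      also have "\<dots> = Determinant.det (Matrix.mat n n
          (\<lambda>(i, k). if i = m then \<phi> k \<sigma> else ?B i k))"
        by (intro arg_cong[where f = Determinant.det] cong_mat) auto
      finally show ?thesis
        by (simp only: c)
    qed
    have int': "set_integrable M (I m) (\<lambda>\<sigma>. \<phi> k \<sigma> * c k)" if "k < n" for k
      using int[OF m that] by simp
    have "0 < (LINT \<sigma>:I m|M. (\<Sum>k<n. \<phi> k \<sigma> * c k))"
    proof (rule set_integral_pos)
      show "set_integrable M (I m) (\<lambda>\<sigma>. \<Sum>k<n. \<phi> k \<sigma> * c k)"
        using int' unfolding set_integrable_def scaleR_sum_right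
        by (intro Bochner_Integration.integrable_sum) auto
      show "AE \<sigma>\<in>I m in M. (\<Sum>k<n. \<phi> k \<sigma> * c k) > 0"
        using J[OF m] by eventually_elim (use step in auto)
    qed (use I m in auto)
    also have "\<dots> = (\<Sum>k<n. (LINT \<sigma>:I m|M. \<phi> k \<sigma>) * c k)"
      using int' unfolding set_lebesgue_integral_def set_integrable_def scaleR_sum_right
      by (subst Bochner_Integration.integral_sum) (auto simp flip: mult.assoc)
    also have "\<dots> = Determinant.det (Matrix.mat n n
        (\<lambda>(i, k). if i < Suc m then LINT s:I i|M. \<phi> k s else \<phi> k (s i)))"
      unfolding c[symmetric] by (intro arg_cong[where f = Determinant.det] cong_mat) auto
    finally show ?case .
  qed
  \<comment> \<open>For \<open>m = n\<close> no evaluated row remains, so any sample points will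
    do.\<close>
  from this[of n undefined] have "0 < Determinant.det (Matrix.mat n n
      (\<lambda>(i, k). if i < n then LINT s:I i|M. \<phi> k s else \<phi> k (undefined i)))"
    by simp
  also have "\<dots> = Determinant.det (Matrix.mat n n (\<lambda>(i, k). LINT s:I i|M. \<phi> k s))"
    by (intro arg_cong[where f = Determinant.det] cong_mat) auto
  finally show ?thesis .
qed

section \<open>Lebesgue--Stieltjes integrals as functions of the upper limit\<close>

lemma derivator_mono: "derivator g \<Longrightarrow> a \<le> b \<Longrightarrow> g a \<le> g b"
  by (auto simp: derivator_def mono_def)

lemma set_integrable_ls_measure:
  fixes f :: "real \<Rightarrow> real"
  assumes g: "derivator g" and f: "f \<in> borel_measurable borel" "bounded (f ` {a..b})"
    and S: "S \<in> sets borel" "S \<subseteq> {a..b}"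
  shows "set_integrable (ls_measure g) S f"
proof -
  obtain B where B: "\<And>s. s \<in> {a..b} \<Longrightarrow> norm (f s) \<le> B"
    using f(2) unfolding bounded_iff by blast
  \<comment> \<open>Adding 1 covers the closed interval by a half-open one of known mass;
    \<open>min a b\<close> keeps its endpoints ordered even if \<open>a > b\<close>.\<close>
  have "emeasure (ls_measure g) S \<le> emeasure (ls_measure g) {min a b..<b + 1}"
    using S by (intro emeasure_mono) auto
  also have "\<dots> < \<infinity>"
    using emeasure_ls_measure[OF g, of "min a b" "b + 1"] by simp
  finally have "emeasure (ls_measure g) S < \<infinity>" .
  moreover have "AE s\<in>S in ls_measure g. norm (f s) \<le> B"
    using S(2) B by (intro AE_I2) auto
  moreover have "f \<in> borel_measurable (ls_measure g)"
    using f(1) by (simp cong: measurable_cong_sets)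
  ultimately show ?thesis
    unfolding set_integrable_def using S(1)
    by (intro integrableI_bounded_set_indicator[where B = B]) auto
qed

section \<open>Regularity of integrals and of the g-monomials\<close>

text \<open>A class that contains the monotone functions, is integrable on bounded Borel sets, and
  is preserved by integration up to a variable limit, so that it passes through the recursion for
  \<open>gmonomial\<close>.\<close>

definition locally_bounded_borel :: "(real \<Rightarrow> real) \<Rightarrow> bool" where
  "locally_bounded_borel f \<longleftrightarrow>
     f \<in> borel_measurable borel \<and> (\<forall>a b. bounded (f ` {a..b}))"

lemma set_integrable_locally_bounded:
  assumes "derivator g" "locally_bounded_borel f" "S \<in> sets borel" "S \<subseteq> {a..b}"
  shows "set_integrable (ls_measure g) S f"
  using assms set_integrable_ls_measure[of g f a b S] by (auto simp: locally_bounded_borel_def)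

lemma ls_integral_diff_eq:
  assumes g: "derivator g" and f: "locally_bounded_borel f" and "a \<le> b"
  shows "ls_integral g y b f - ls_integral g y a f = (LINT s:{a..<b}|ls_measure g. f s)"
proof -
  have split: "(LINT s:{p..<r}|ls_measure g. f s) =
      (LINT s:{p..<q}|ls_measure g. f s) + (LINT s:{q..<r}|ls_measure g. f s)"
    if "p \<le> q" "q \<le> r" for p q r
  proof -
    have "{p..<r} = {p..<q} \<union> {q..<r}"
      using that by auto
    then show ?thesis
      using set_integrable_locally_bounded[OF g f, of "{p..<q}" p r]
        set_integrable_locally_bounded[OF g f, of "{q..<r}" p r] that
      by (simp add: set_integral_Un less_imp_le subset_eq)
  qed
  \<comment> \<open>The sign convention in \<open>ls_integral\<close> depends on where the base
    point \<open>y\<close> lies; each position is one instance of \<open>split\<close>.\<close>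
  consider "y \<le> a" | "a < y" "y \<le> b" | "b < y"
    by linarith
  then show ?thesis
  proof cases
    case 1
    then show ?thesis
      using split[of y a b] \<open>a \<le> b\<close> by (simp add: ls_integral_def)
  next
    case 2
    then show ?thesis
      using split[of a y b] by (simp add: ls_integral_def)
  next
    case 3
    then show ?thesis
      using split[of a b y] \<open>a \<le> b\<close> by (simp add: ls_integral_def)
  qed
qed

lemma mono_ls_integral:
  assumes "derivator g" "locally_bounded_borel f" "\<And>s. f s \<ge> 0"
  shows "mono (\<lambda>t. ls_integral g y t f)"
proof
  fix a b :: real
  assume "a \<le> b"
  have "(LINT s:{a..<b}|ls_measure g. f s) \<ge> 0"
    using assms(3) by (auto simp: set_lebesgue_integral_def intro!: integral_nonneg_AE)
  then show "ls_integral g y a f \<le> ls_integral g y b f"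
    using ls_integral_diff_eq[OF assms(1,2) \<open>a \<le> b\<close>, of y] by simp
qed

lemma locally_bounded_borel_mono:
  assumes "mono f"
  shows "locally_bounded_borel f"
proof -
  have "bounded (f ` {a..b})" for a b
    using assms by (intro boundedI[of _ "\<bar>f a\<bar> + \<bar>f b\<bar>"])
      (fastforce dest: monoD simp: abs_le_iff)
  then show ?thesis
    using borel_measurable_mono[OF assms] by (simp add: locally_bounded_borel_def)
qed

lemma locally_bounded_borel_diff:
  assumes "locally_bounded_borel f" "locally_bounded_borel h"
  shows "locally_bounded_borel (\<lambda>t. f t - h t)"
  using assms by (auto simp: locally_bounded_borel_def intro!: bounded_minus_comp)

lemma locally_bounded_borel_cmult:
  assumes "locally_bounded_borel f"
  shows "locally_bounded_borel (\<lambda>t. c * f t)"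
  using assms bounded_scaling[of "f ` {_.._}" c]
  by (auto simp: locally_bounded_borel_def image_image)

lemma locally_bounded_borel_abs:
  assumes "locally_bounded_borel f"
  shows "locally_bounded_borel (\<lambda>t. \<bar>f t\<bar>)"
  using assms by (auto simp: locally_bounded_borel_def bounded_iff)

text \<open>Splitting \<open>f\<close> as \<open>\<bar>f\<bar> - (\<bar>f\<bar> - f)\<close> exhibits the integral as a difference of monotone functions.\<close>

lemma locally_bounded_borel_ls_integral:
  assumes g: "derivator g" and f: "locally_bounded_borel f"
  shows "locally_bounded_borel (\<lambda>t. ls_integral g y t f)"
proof -
  let ?p = "\<lambda>s. \<bar>f s\<bar>" and ?q = "\<lambda>s. \<bar>f s\<bar> - f s"
  have p: "locally_bounded_borel ?p" and q: "locally_bounded_borel ?q"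
    using f by (auto intro: locally_bounded_borel_abs locally_bounded_borel_diff)
  have "locally_bounded_borel (\<lambda>t. ls_integral g y t ?p - ls_integral g y t ?q)"
    using mono_ls_integral[OF g p] mono_ls_integral[OF g q]
    by (simp add: locally_bounded_borel_diff locally_bounded_borel_mono)
  moreover have "ls_integral g y t ?p - ls_integral g y t ?q = ls_integral g y t f" for t
  proof -
    have "(LINT s:{a..<b}|ls_measure g. ?q s) =
        (LINT s:{a..<b}|ls_measure g. ?p s) - (LINT s:{a..<b}|ls_measure g. f s)" for a b
      using set_integrable_locally_bounded[OF g f, of "{a..<b}" a b]
        set_integrable_locally_bounded[OF g p, of "{a..<b}" a b]
      by (intro set_integral_diff) (auto simp: subset_eq)
    then show ?thesis
      by (simp add: ls_integral_def)
  qed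
  ultimately show ?thesis
    by simp
qed

lemma locally_bounded_borel_gmonomial:
  assumes "derivator g"
  shows "locally_bounded_borel (gmonomial g y k)"
proof (induction k)
  case 0
  then show ?case
    by (auto simp: mono_def intro: locally_bounded_borel_mono)
next
  case (Suc k)
  then show ?case
    using assms by (auto intro!: locally_bounded_borel_cmult locally_bounded_borel_ls_integral)
qed

section \<open>Right-hand limits and values at formal points\<close>

text \<open>Continuity from above: as \<open>t\<close> decreases to \<open>a\<close>, the intervals
  \<open>{c..<t}\<close> shrink to the closed \<open>{c..a}\<close>, so a possible atom at
  \<open>a\<close> is counted.\<close>

lemma tendsto_ls_integral_at_right:
  assumes g: "derivator g" and f: "locally_bounded_borel f" and "c \<le> a"
  shows "((\<lambda>t. ls_integral g y t f) \<longlongrightarrow>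
    ls_integral g y c f + (LINT s:{c..a}|ls_measure g. f s)) (at_right a)"
proof (rule tendsto_at_right_sequentially[of a "a + 1"])
  fix S :: "nat \<Rightarrow> real"
  assume S: "\<And>n. a < S n" "decseq S" "S \<longlonglongrightarrow> a"
  have "(\<lambda>n. LINT s:{c..<S n}|ls_measure g. f s) \<longlonglongrightarrow>
      (LINT s:(\<Inter>n. {c..<S n})|ls_measure g. f s)"
    using S by (intro set_integral_cont_down
        set_integrable_locally_bounded[OF g f, where a = c and b = "S 0"])
      (auto simp: decseq_def intro: order.strict_trans2)
  moreover have "(\<Inter>n. {c..<S n}) = {c..a}"
  proof safe
    fix s assume "s \<in> (\<Inter>n. {c..<S n})"
    then have s: "c \<le> s" "s < S n" for n
      by auto
    then have "s \<le> a"
      using S(3) by (intro LIMSEQ_le_const) (auto intro: less_imp_le)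
    with s show "s \<in> {c..a}"
      by simp
  qed (use S(1) in \<open>auto intro: order.strict_trans1\<close>)
  moreover have "ls_integral g y (S n) f = ls_integral g y c f + (LINT s:{c..<S n}|ls_measure g. f s)"
    for n
    using ls_integral_diff_eq[OF g f, of c "S n" y] S(1)[of n] \<open>c \<le> a\<close> by simp
  ultimately show "(\<lambda>n. ls_integral g y (S n) f) \<longlonglongrightarrow>
      ls_integral g y c f + (LINT s:{c..a}|ls_measure g. f s)"
    by (auto intro: tendsto_add)
qed simp

text \<open>\<open>Lim\<close> is a description operator and says nothing until a limit is known to
  exist; existence comes from the integral representation.\<close>

lemma tendsto_gmonomial_at_right:
  assumes "derivator g"
  shows "(gmonomial g y k \<longlongrightarrow> Lim (at_right a) (gmonomial g y k)) (at_right a)"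
proof -
  have "\<exists>l. (gmonomial g y k \<longlongrightarrow> l) (at_right a)"
  proof (cases k)
    case (Suc j)
    show ?thesis
      unfolding Suc gmonomial.simps
      by (rule exI, rule tendsto_mult_left, rule tendsto_ls_integral_at_right[OF assms])
        (auto intro: locally_bounded_borel_gmonomial assms)
  qed auto
  then show ?thesis
    by (metis tendsto_Lim trivial_limit_at_right_real)
qed

text \<open>
  With this definition \<open>left_of v - left_of u\<close> stands for \<open>[u, v)\<close> also when \<open>u\<close> or \<open>v\<close> is a
  formal point \<open>t\<^sup>+\<close>.
\<close>

fun left_of :: "real + real \<Rightarrow> real set" where
  "left_of (Inl a) = {..<a}"
| "left_of (Inr a) = {..a}"

lemma sets_left_of [measurable]: "left_of u \<in> sets borel"
  by (cases u) auto

lemma left_of_bounds: obtains c d where "{..<c} \<subseteq> left_of u" "left_of u \<subseteq> {..d}"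
  by (cases u) (auto intro: that[of "case_sum id id u" "case_sum id id u"])

text \<open>The auxiliary \<open>c\<close> cuts \<open>left_of u\<close> down to a bounded set,
  since \<open>left_of u\<close> itself may have infinite measure.\<close>

lemma eval_plus_ls_integral:
  assumes g: "derivator g" and f: "locally_bounded_borel f" and c: "{..<c} \<subseteq> left_of u"
  shows "eval_plus (\<lambda>t. ls_integral g y t f) u =
    ls_integral g y c f + (LINT s:left_of u - {..<c}|ls_measure g. f s)"
proof (cases u)
  case (Inl a)
  then have "c \<le> a" "left_of u - {..<c} = {c..<a}"
    using c lessThan_subset_iff[of c a] by auto
  then show ?thesis
    using ls_integral_diff_eq[OF g f, of c a y] Inl by simp
next
  case (Inr a)
  have "c \<le> a"
    using c Inr dense_le[of c a] by auto
  moreover have "left_of u - {..<c} = {c..a}"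
    using Inr by auto
  ultimately show ?thesis
    using tendsto_Lim[OF _ tendsto_ls_integral_at_right[OF g f, of c a y]] Inr by simp
qed

text \<open>Both values are computed from a common base point \<open>c\<close> to the left of
  \<open>u\<close>; the inclusion then splits the set for \<open>v\<close> disjointly.\<close>

lemma eval_plus_ls_integral_diff:
  assumes g: "derivator g" and f: "locally_bounded_borel f" and uv: "left_of u \<subseteq> left_of v"
  shows "eval_plus (\<lambda>t. ls_integral g y t f) v - eval_plus (\<lambda>t. ls_integral g y t f) u =
    (LINT s:left_of v - left_of u|ls_measure g. f s)"
proof -
  obtain c where c: "{..<c} \<subseteq> left_of u"
    using left_of_bounds by metis
  obtain d where d: "left_of v \<subseteq> {..d}"
    using left_of_bounds by metis
  have int: "set_integrable (ls_measure g) S f" if "S \<in> sets borel" "S \<subseteq> left_of v - {..<c}" for S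
    using that d by (intro set_integrable_locally_bounded[OF g f, of S c d]) force+
  have "left_of v - {..<c} = (left_of u - {..<c}) \<union> (left_of v - left_of u)"
    using c uv by auto
  then have "(LINT s:left_of v - {..<c}|ls_measure g. f s) =
      (LINT s:left_of u - {..<c}|ls_measure g. f s) + (LINT s:left_of v - left_of u|ls_measure g. f s)"
    using c uv by (subst set_integral_Un[symmetric]) (auto intro!: int)
  then show ?thesis
    using eval_plus_ls_integral[OF g f, of c u y] eval_plus_ls_integral[OF g f, of c v y] c uv
    by auto
qed

section \<open>Positivity of the determinant and interpolation\<close>

text \<open>Facts about g-monomials, such as right-hand limits and integral formulas, transfer to
  \<open>g\<close> itself through this identity.\<close>

lemma gmonomial_one:
  assumes g: "derivator g"
  shows "gmonomial g y (Suc 0) t = g t - g y"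
proof -
  have "(LINT s:{a..<b}|ls_measure g. 1) = g b - g a" if "a \<le> b" for a b
    using emeasure_ls_measure[OF g that] derivator_mono[OF g that]
    by (simp add: set_lebesgue_integral_def measure_def)
  then show ?thesis
    by (auto simp: ls_integral_def)
qed

lemma tendsto_derivator_at_right:
  assumes g: "derivator g"
  shows "(g \<longlongrightarrow> Lim (at_right a) g) (at_right a)"
proof -
  have "((\<lambda>t. gmonomial g 0 (Suc 0) t + g 0) \<longlongrightarrow> Lim (at_right a) (gmonomial g 0 (Suc 0)) + g 0)
      (at_right a)"
    by (intro tendsto_add tendsto_gmonomial_at_right g tendsto_const)
  then have "(g \<longlongrightarrow> Lim (at_right a) (gmonomial g 0 (Suc 0)) + g 0) (at_right a)"
    unfolding gmonomial_one[OF g] by simp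
  then show ?thesis
    by (metis tendsto_Lim trivial_limit_at_right_real)
qed

text \<open>At a formal point the bound holds for \<open>g t\<close> at every \<open>t\<close> to
  the right and survives the limit. With its counterpart below it shows that
  \<open>left_of u\<close> cuts the line at the level \<open>eval_plus g u\<close>.\<close>

lemma le_eval_plus_derivator:
  assumes g: "derivator g" and "s \<in> left_of u"
  shows "g s \<le> eval_plus g u"
proof (cases u)
  case (Inr a)
  have "eventually (\<lambda>t. g s \<le> g t) (at_right a)"
    using assms Inr by (intro eventually_at_right_less[THEN eventually_mono]) (auto intro: derivator_mono)
  then show ?thesis
    using tendsto_lowerbound[OF tendsto_derivator_at_right[OF g, of a]] Inr by simp
qed (use assms in \<open>auto intro: derivator_mono\<close>)

lemma eval_plus_derivator_le:
  assumes g: "derivator g" and "s \<notin> left_of u"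
  shows "eval_plus g u \<le> g s"
proof (cases u)
  case (Inr a)
  then have "a < s"
    using assms by simp
  then have "eventually (\<lambda>t. g t \<le> g s) (at_right a)"
    unfolding eventually_at_right_field
    by (intro exI[of _ s] conjI allI impI derivator_mono[OF g]) auto
  then show ?thesis
    using tendsto_upperbound[OF tendsto_derivator_at_right[OF g, of a]] Inr by simp
qed (use assms in \<open>auto intro: derivator_mono\<close>)

text \<open>A point of \<open>left_of u\<close> outside \<open>left_of v\<close> would have a value
  of \<open>g\<close> at least that of \<open>v\<close> and at most that of
  \<open>u\<close>.\<close>

lemma left_of_mono:
  assumes "derivator g" "eval_plus g u < eval_plus g v"
  shows "left_of u \<subseteq> left_of v"
proof
  fix s assume "s \<in> left_of u"
  then show "s \<in> left_of v"
    using le_eval_plus_derivator[of g s u] eval_plus_derivator_le[of g s v] assms by force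
qed

lemma eval_plus_gmonomial_diff:
  assumes g: "derivator g" and uv: "left_of u \<subseteq> left_of v"
  shows "eval_plus (gmonomial g y (Suc k)) v - eval_plus (gmonomial g y (Suc k)) u =
    real (Suc k) * (LINT s:left_of v - left_of u|ls_measure g. gmonomial g y k s)"
proof -
  note f = locally_bounded_borel_gmonomial[OF g, of y k]
  have "eval_plus (gmonomial g y (Suc k)) w =
      real (Suc k) * eval_plus (\<lambda>t. ls_integral g y t (gmonomial g y k)) w" for w
  proof (cases w)
    case (Inr a)
    define L where "L = ls_integral g y a (gmonomial g y k) +
      (LINT s:{a..a}|ls_measure g. gmonomial g y k s)"
    have L: "((\<lambda>t. ls_integral g y t (gmonomial g y k)) \<longlongrightarrow> L) (at_right a)"
      unfolding L_def by (rule tendsto_ls_integral_at_right[OF g f order_refl])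
    have "(gmonomial g y (Suc k) \<longlongrightarrow> real (Suc k) * L) (at_right a)"
      unfolding gmonomial.simps by (rule tendsto_mult_left[OF L])
    then have "Lim (at_right a) (gmonomial g y (Suc k)) = real (Suc k) * L"
      by (rule tendsto_Lim[rotated]) (rule trivial_limit_at_right_real)
    moreover have "Lim (at_right a) (\<lambda>t. ls_integral g y t (gmonomial g y k)) = L"
      using L by (rule tendsto_Lim[rotated]) (rule trivial_limit_at_right_real)
    ultimately show ?thesis
      by (simp only: Inr eval_plus.simps)
  qed simp
  then show ?thesis
    using eval_plus_ls_integral_diff[OF g f uv, of y] by (simp only: flip: right_diff_distrib)
qed

text \<open>The integral of 1 over this set is the increment of \<open>g\<close>, by the case
  \<open>k = 0\<close> of the previous lemma; over a null set it would be 0.\<close>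

lemma emeasure_left_of_diff:
  assumes g: "derivator g" and uv: "eval_plus g u < eval_plus g v"
  shows "emeasure (ls_measure g) (left_of v - left_of u) \<noteq> 0"
proof
  assume null: "emeasure (ls_measure g) (left_of v - left_of u) = 0"
  have eval: "eval_plus (gmonomial g 0 (Suc 0)) w = eval_plus g w - g 0" for w
  proof (cases w)
    case (Inr a)
    have "((\<lambda>t. gmonomial g 0 (Suc 0) t) \<longlongrightarrow> Lim (at_right a) g - g 0) (at_right a)"
      unfolding gmonomial_one[OF g] by (intro tendsto_diff tendsto_derivator_at_right g tendsto_const)
    then show ?thesis
      using Inr by (simp add: tendsto_Lim del: gmonomial.simps)
  qed (use gmonomial_one[OF g] in simp)
  have "(LINT s:left_of v - left_of u|ls_measure g. 1) = eval_plus g v - eval_plus g u"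
    using eval_plus_gmonomial_diff[OF g left_of_mono[OF g uv], of 0 0] unfolding eval by simp
  moreover have "(LINT s:left_of v - left_of u|ls_measure g. (1::real)) = 0"
    using null by (simp add: set_lebesgue_integral_def measure_def)
  ultimately show False
    using uv by simp
qed

text \<open>
  The exceptional set for \<open>v = Inl b\<close> is \<open>N = {s. s < b \<and> g s = g b}\<close>; it is covered by
  countably many null intervals \<open>{s..<b}\<close> with \<open>s \<in> N\<close>, the least element of \<open>N\<close> (if any) having
  to be added to the rational ones.
\<close>

lemma AE_less_eval_plus:
  assumes g: "derivator g" and v: "v \<in> real_plus g"
  shows "AE s\<in>left_of v in ls_measure g. g s < eval_plus g v"
proof (cases v)
  case (Inl b)
  define N where "N = {s. s < b \<and> g s = g b}"
  define C where "C = (N \<inter> \<rat>) \<union> {s \<in> N. \<forall>r\<in>N. s \<le> r}"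
  have "{s \<in> N. \<forall>r\<in>N. s \<le> r} \<subseteq> {Inf N}"
    by (auto intro: cInf_eq_minimum[symmetric])
  then have "countable C"
    unfolding C_def by (intro countable_Un countable_Int2 countable_rat)
      (metis countable_finite finite.emptyI finite_insert finite_subset)
  moreover have "{s..<b} \<in> null_sets (ls_measure g)" if "s \<in> C" for s
    using that emeasure_ls_measure[OF g, of s b] by (auto simp: C_def N_def)
  ultimately have null: "(\<Union>s\<in>C. {s..<b}) \<in> null_sets (ls_measure g)"
    by (intro null_sets_UN') auto
  have "\<exists>s\<in>C. s \<le> t" if t: "t \<in> N" for t
  proof (cases "\<forall>r\<in>N. t \<le> r")
    case True
    then show ?thesis
      using t by (auto simp: C_def)
  next
    case False
    then obtain r where r: "r \<in> N" "r < t"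
      by auto
    \<comment> \<open>As \<open>g r = g t = g b\<close>, monotonicity makes \<open>g\<close>
      constant between them, so the rational \<open>q\<close> lies in \<open>N\<close>.\<close>
    then obtain q where q: "q \<in> \<rat>" "r < q" "q < t"
      using Rats_dense_in_real by blast
    then have "g r \<le> g q" "g q \<le> g b" "q < b"
      using t by (auto simp: N_def intro: derivator_mono[OF g])
    then have "q \<in> N"
      using r by (auto simp: N_def)
    then show ?thesis
      using q by (auto simp: C_def intro!: bexI[of _ q])
  qed
  moreover have "s \<in> N" if "s < b" "\<not> g s < g b" for s
    using that derivator_mono[OF g, of s b] by (simp add: N_def)
  ultimately have "{s \<in> space (ls_measure g). \<not> (s \<in> left_of v \<longrightarrow> g s < eval_plus g v)}
      \<subseteq> (\<Union>s\<in>C. {s..<b})"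
    using Inl by (simp add: subset_eq Bex_def)
  with null show ?thesis
    by (rule AE_I')
next
  case (Inr b)
  \<comment> \<open>Formal points exist only at jumps, so strictness holds at \<open>b\<close> and,
    by monotonicity, at all earlier points without exception.\<close>
  then have "g b < eval_plus g v"
    using v by (auto simp: real_plus_def jump_set_def)
  then show ?thesis
    using Inr by (auto intro!: AE_I2 intro: le_less_trans[OF derivator_mono[OF g]])
qed

section \<open>Positivity by induction on the number of points\<close>

lemma det_gmonomial_pos:
  assumes g: "derivator g"
    and "\<And>i. i \<le> n \<Longrightarrow> x i \<in> real_plus g"
    and "\<And>i j. i < j \<Longrightarrow> j \<le> n \<Longrightarrow> eval_plus g (x i) < eval_plus g (x j)"
  shows "Determinant.det (Matrix.mat (Suc n) (Suc n)
    (\<lambda>(i, k). eval_plus (gmonomial g y k) (x i))) > 0"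
  using assms(2,3)
proof (induction n arbitrary: x)
  have one: "eval_plus (gmonomial g y 0) u = 1" for u
    by (cases u) (auto simp: tendsto_Lim)
  {
    case 0
    show ?case
      using one by (simp add: det_single)
  next
    case (Suc n)
    define I where "I i = left_of (x (Suc i)) - left_of (x i)" for i
    define \<Phi> where "\<Phi> i k = (LINT s:I i|ls_measure g. gmonomial g y k s)" for i k
    have step: "eval_plus g (x i) < eval_plus g (x (Suc i))" if "i < Suc n" for i
      using Suc.prems(2)[of i "Suc i"] that by simp
    have int: "set_integrable (ls_measure g) (I i) (gmonomial g y k)" for i k
    proof -
      obtain c where "{..<c} \<subseteq> left_of (x i)"
        using left_of_bounds by metis
      moreover obtain d where "left_of (x (Suc i)) \<subseteq> {..d}"
        using left_of_bounds by metis
      ultimately have "I i \<subseteq> {c..d}"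
        by (force simp: I_def)
      then show ?thesis
        using set_integrable_locally_bounded[OF g locally_bounded_borel_gmonomial[OF g]]
        by (simp add: I_def)
    qed
    have "Determinant.det (Matrix.mat (Suc n) (Suc n) (\<lambda>(i, k). \<Phi> i k)) > 0"
      unfolding \<Phi>_def
    proof (rule det_integral_rows_pos)
      fix i assume i: "i < Suc n"
      show "emeasure (ls_measure g) (I i) \<noteq> 0"
        using emeasure_left_of_diff[OF g step[OF i]] by (simp add: I_def)
      \<comment> \<open>Membership in \<open>I i\<close> gives only a weak inequality at the right
        end; discarding a null set makes it strict, so that sample points have distinct
        values.\<close>
      show "AE s\<in>I i in ls_measure g. s \<in> {s \<in> I i. g s < eval_plus g (x (Suc i))}"
        using AE_less_eval_plus[OF g Suc.prems(1), of "Suc i"] i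
        by (auto simp: I_def elim!: AE_mp)
    next
      fix s assume s: "\<And>i. i < Suc n \<Longrightarrow> s i \<in> {s \<in> I i. g s < eval_plus g (x (Suc i))}"
      \<comment> \<open>The induction hypothesis is used at the sample points, which are ordinary
        reals; hence the induction is over arbitrary \<open>x\<close>.\<close>
      have "Determinant.det (Matrix.mat (Suc n) (Suc n)
          (\<lambda>(i, k). eval_plus (gmonomial g y k) (Inl (s i)))) > 0"
      proof (rule Suc.IH)
        fix i j :: nat
        assume ij: "i < j" "j \<le> n"
        have "g (s i) < eval_plus g (x (Suc i))"
          using s[of i] ij by simp
        also have "\<dots> \<le> eval_plus g (x j)"
          using Suc.prems(2)[of "Suc i" j] ij by (cases "Suc i = j") auto
        also have "\<dots> \<le> g (s j)"
          using s[of j] ij by (intro eval_plus_derivator_le[OF g]) (auto simp: I_def)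
        finally show "eval_plus g (Inl (s i)) < eval_plus g (Inl (s j))"
          by simp
      qed (auto simp: real_plus_def)
      then show "Determinant.det (Matrix.mat (Suc n) (Suc n) (\<lambda>(i, k). gmonomial g y k (s i))) > 0"
        by simp
    qed (use int in \<open>auto simp: I_def\<close>)
    \<comment> \<open>Column \<open>k\<close> receives the factor \<open>Suc k\<close> from the
      recursion; the product of these factors is (n+1)! and hence positive.\<close>
    then have "0 < Determinant.det (Matrix.mat (Suc n) (Suc n) (\<lambda>(i, k). real (Suc k) * \<Phi> i k))"
      unfolding det_scale_columns by (intro mult_pos_pos prod_pos) auto
    also have "\<dots> = Determinant.det (Matrix.mat (Suc n) (Suc n)
        (\<lambda>(i, k). eval_plus (gmonomial g y (Suc k)) (x (Suc i)) -
          eval_plus (gmonomial g y (Suc k)) (x i)))"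
      using eval_plus_gmonomial_diff[OF g left_of_mono[OF g step]]
      by (intro arg_cong[where f = Determinant.det] cong_mat)
        (auto simp: \<Phi>_def I_def simp del: gmonomial.simps)
    also have "\<dots> = Determinant.det (Matrix.mat (Suc (Suc n)) (Suc (Suc n))
        (\<lambda>(i, k). eval_plus (gmonomial g y k) (x i)))"
      using one by (intro det_consecutive_differences[symmetric])
    finally show ?case .
  }
qed

section \<open>Unique interpolation\<close>

lemma eval_plus_sum_gmonomial:
  fixes c :: "nat \<Rightarrow> 'a::real_normed_field"
  assumes "derivator g"
  shows "eval_plus (\<lambda>t. \<Sum>k\<le>n. c k * of_real (gmonomial g y k t)) u =
    (\<Sum>k\<le>n. c k * of_real (eval_plus (gmonomial g y k) u))"
proof (cases u)
  case (Inr a)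
  have "((\<lambda>t. \<Sum>k\<le>n. c k * of_real (gmonomial g y k t)) \<longlongrightarrow>
      (\<Sum>k\<le>n. c k * of_real (Lim (at_right a) (gmonomial g y k)))) (at_right a)"
    by (intro tendsto_intros tendsto_gmonomial_at_right assms)
  then show ?thesis
    using Inr by (simp add: tendsto_Lim)
qed simp

text \<open>The matrix has a two-sided inverse \<open>B\<close>: existence uses
  \<open>?A * B = 1\<close>, uniqueness \<open>B * ?A = 1\<close>.\<close>

lemma linear_system_det_nonzero:
  fixes a :: "nat \<Rightarrow> nat \<Rightarrow> 'a::field"
  assumes "Determinant.det (Matrix.mat n n (\<lambda>(i, k). a i k)) \<noteq> 0"
  shows "\<exists>c. \<forall>i<n. (\<Sum>k<n. a i k * c k) = t i"
    and "(\<And>i. i < n \<Longrightarrow> (\<Sum>k<n. a i k * c k) = (\<Sum>k<n. a i k * d k)) \<Longrightarrow> k < n \<Longrightarrow> c k = d k"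
proof -
  let ?A = "Matrix.mat n n (\<lambda>(i, k). a i k)"
  have A: "?A \<in> carrier_mat n n"
    by simp
  obtain B where B: "B \<in> carrier_mat n n" "?A * B = 1\<^sub>m n" "B * ?A = 1\<^sub>m n"
    using det_non_zero_imp_unit[OF A assms, of undefined] by (auto simp: Units_def ring_mat_simps)
  have app: "vec_index (?A *\<^sub>v Matrix.vec n c) i = (\<Sum>k<n. a i k * c k)" if "i < n" for i c
    using that by (simp add: scalar_prod_def lessThan_atLeast0)
  define w where "w = B *\<^sub>v Matrix.vec n t"
  have w: "w \<in> carrier_vec n"
    using B by (simp add: w_def)
  then have "w = Matrix.vec n (\<lambda>k. vec_index w k)"
    by auto
  moreover have "?A *\<^sub>v w = Matrix.vec n t"
    unfolding w_def using B(1,2) assoc_mult_mat_vec[OF A B(1), of "Matrix.vec n t"] by simp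
  ultimately show "\<exists>c. \<forall>i<n. (\<Sum>k<n. a i k * c k) = t i"
    using app by (metis index_vec)
  assume eq: "\<And>i. i < n \<Longrightarrow> (\<Sum>k<n. a i k * c k) = (\<Sum>k<n. a i k * d k)" and "k < n"
  have "?A *\<^sub>v Matrix.vec n c = ?A *\<^sub>v Matrix.vec n d"
    using eq app by (intro eq_vecI) auto
  then have "(B * ?A) *\<^sub>v Matrix.vec n c = (B * ?A) *\<^sub>v Matrix.vec n d"
    using assoc_mult_mat_vec[OF B(1) A, of "Matrix.vec n _"] by simp
  then have "Matrix.vec n c = Matrix.vec n d"
    using B by simp
  with \<open>k < n\<close> show "c k = d k"
    by (metis index_vec)
qed

lemma ex1_gpolys_interpolation:
  fixes t :: "nat \<Rightarrow> 'a::real_normed_field"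
  assumes g: "derivator g"
    and det: "Determinant.det (Matrix.mat (Suc n) (Suc n)
      (\<lambda>(i, k). eval_plus (gmonomial g z0 k) (x i))) \<noteq> 0"
  shows "\<exists>!p. p \<in> gpolys g z0 n \<and> (\<forall>i\<le>n. eval_plus p (x i) = t i)"
proof -
  define a where "a i k = (of_real (eval_plus (gmonomial g z0 k) (x i)) :: 'a)" for i k
  define P where "P c = (\<lambda>t. \<Sum>k\<le>n. c k * of_real (gmonomial g z0 k t) :: 'a)" for c
  \<comment> \<open>The ring homomorphism \<open>of_real\<close> commutes with determinants, so the
    real determinant controls the system over \<open>'a\<close>, real or complex.\<close>
  have "Matrix.mat (Suc n) (Suc n) (\<lambda>(i, k). a i k) = map_mat of_real
      (Matrix.mat (Suc n) (Suc n) (\<lambda>(i, k). eval_plus (gmonomial g z0 k) (x i)))"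
    by (auto simp: a_def)
  then have "Determinant.det (Matrix.mat (Suc n) (Suc n) (\<lambda>(i, k). a i k)) \<noteq> 0"
    using det by (simp add: of_real_hom.hom_det)
  note sol = linear_system_det_nonzero[OF this]
  have eval: "eval_plus (P c) (x i) = (\<Sum>k<Suc n. a i k * c k)" for c i
    unfolding P_def eval_plus_sum_gmonomial[OF g] a_def lessThan_Suc_atMost
    by (simp add: mult.commute)
  obtain c where c: "\<forall>i<Suc n. (\<Sum>k<Suc n. a i k * c k) = t i"
    using sol(1) by blast
  show ?thesis
  proof (rule ex1I[of _ "P c"])
    show "P c \<in> gpolys g z0 n \<and> (\<forall>i\<le>n. eval_plus (P c) (x i) = t i)"
      using c eval by (auto simp: gpolys_iff P_def less_Suc_eq_le)
  next
    fix p assume p: "p \<in> gpolys g z0 n \<and> (\<forall>i\<le>n. eval_plus p (x i) = t i)"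
    then obtain d where d: "p = P d"
      by (auto simp: gpolys_iff P_def)
    have "(\<Sum>k<Suc n. a i k * d k) = (\<Sum>k<Suc n. a i k * c k)" if "i < Suc n" for i
    proof -
      have "(\<Sum>k<Suc n. a i k * d k) = eval_plus p (x i)"
        by (simp only: d eval)
      also have "\<dots> = t i"
        using p that by simp
      finally show ?thesis
        using c that by metis
    qed
    then have "d k = c k" if "k < Suc n" for k
      using that by (rule sol(2))
    then show "p = P c"
      unfolding d P_def by (intro ext sum.cong) auto
  qed
qed

text \<open>\<open>\<pi> i\<close> is the index at which the value in position \<open>i\<close> of
  the sorted list is attained.\<close>

lemma sorting_reindexing:
  fixes v :: "nat \<Rightarrow> 'a::linorder"
  assumes "inj_on v {..n}"
  obtains \<pi> where "bij_betw \<pi> {..n} {..n}" "\<And>i j. i < j \<Longrightarrow> j \<le> n \<Longrightarrow> v (\<pi> i) < v (\<pi> j)"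
proof -
  define xs where "xs = sorted_list_of_set (v ` {..n})"
  have xs: "set xs = v ` {..n}" "length xs = Suc n" "distinct xs" "sorted_wrt (<) xs"
    using assms by (simp_all add: xs_def card_image)
  have "bij_betw (\<lambda>i. xs ! i) {..n} (v ` {..n})"
    using bij_betw_nth[OF xs(3), of "{..n}"] xs by (simp add: lessThan_Suc_atMost)
  moreover have "bij_betw (inv_into {..n} v) (v ` {..n}) {..n}"
    using assms by (simp add: bij_betw_inv_into inj_on_imp_bij_betw)
  ultimately have "bij_betw (inv_into {..n} v \<circ> (\<lambda>i. xs ! i)) {..n} {..n}"
    by (rule bij_betw_trans)
  moreover have "v (inv_into {..n} v (xs ! i)) = xs ! i" if "i \<le> n" for i
    using that xs by (intro f_inv_into_f) (metis le_imp_less_Suc nth_mem)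
  ultimately show ?thesis
    using xs by (intro that[of "inv_into {..n} v \<circ> (\<lambda>i. xs ! i)"])
      (auto simp: sorted_wrt_nth_less)
qed

theorem theorem5p8:
  fixes g :: "real \<Rightarrow> real" and n :: nat and x :: "nat \<Rightarrow> real + real" and z0 :: real
  assumes "derivator g"
    and "\<forall>i\<le>n. x i \<in> real_plus g"
    and "\<forall>i\<le>n. \<forall>j\<le>n. i \<noteq> j \<longrightarrow> eval_plus g (x i) \<noteq> eval_plus g (x j)"
  shows "(\<forall>t :: nat \<Rightarrow> real. \<exists>!p. p \<in> gpolys g z0 n \<and> (\<forall>i\<le>n. eval_plus p (x i) = t i)) \<and>
    (\<forall>t :: nat \<Rightarrow> complex. \<exists>!p. p \<in> gpolys g z0 n \<and> (\<forall>i\<le>n. eval_plus p (x i) = t i)) \<and>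
    ((\<forall>i\<le>n. \<forall>j\<le>n. i < j \<longrightarrow> eval_plus g (x i) < eval_plus g (x j)) \<longrightarrow>
      (\<forall>y0 :: real. Determinant.det
        (Matrix.mat (n + 1) (n + 1) (\<lambda>(i, k). eval_plus (gmonomial g y0 k) (x i))) > 0))"
proof -
  have "inj_on (\<lambda>i. eval_plus g (x i)) {..n}"
    using assms(3) by (auto simp: inj_on_def)
  then obtain \<pi> where bij: "bij_betw \<pi> {..n} {..n}"
    and less: "\<And>i j. i < j \<Longrightarrow> j \<le> n \<Longrightarrow> eval_plus g (x (\<pi> i)) < eval_plus g (x (\<pi> j))"
    using sorting_reindexing[of "\<lambda>i. eval_plus g (x i)" n] by metis
  have \<pi>: "\<pi> i \<le> n" if "i \<le> n" for i
    using bij_betwE[OF bij] that by simp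
  \<comment> \<open>The interpolation conditions are insensitive to order, so the data
    \<open>t\<close> are permuted along with the points and the result is carried back.\<close>
  have all_\<pi>: "(\<forall>i\<le>n. R (\<pi> i)) \<longleftrightarrow> (\<forall>i\<le>n. R i)" for R
    using ball_simps(9)[of \<pi> "{..n}" R] unfolding bij_betw_imp_surj_on[OF bij] by auto
  have det: "Determinant.det (Matrix.mat (Suc n) (Suc n)
      (\<lambda>(i, k). eval_plus (gmonomial g z0 k) (x (\<pi> i)))) \<noteq> 0"
    using det_gmonomial_pos[of g n "\<lambda>i. x (\<pi> i)" z0] assms(1,2) \<pi> less by fastforce
  have real: "\<exists>!p. p \<in> gpolys g z0 n \<and> (\<forall>i\<le>n. eval_plus p (x i) = t i)" for t :: "nat \<Rightarrow> real"
    using ex1_gpolys_interpolation[OF assms(1) det, of "\<lambda>i. t (\<pi> i)"]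
    unfolding all_\<pi>[of "\<lambda>i. eval_plus _ (x i) = t i"] .
  have complex: "\<exists>!p. p \<in> gpolys g z0 n \<and> (\<forall>i\<le>n. eval_plus p (x i) = t i)"
    for t :: "nat \<Rightarrow> complex"
    using ex1_gpolys_interpolation[OF assms(1) det, of "\<lambda>i. t (\<pi> i)"]
    unfolding all_\<pi>[of "\<lambda>i. eval_plus _ (x i) = t i"] .
  show ?thesis
    using real complex det_gmonomial_pos[of g n x] assms(1,2) by auto
qed

end
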